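(* Let $\bm A\in\mathbb{R}^{m\times n}$, $\bm y\in\mathbb{R}^m$, $\lambda>0$ and $\alpha>0$. Let $\bm x(t)\in\mathbb{R}^n$, $t\ge 0$, be the solution of the nonlinear ODE $$\frac{d\bm x(t)}{dt}=-\left(\bm A^T(\bm A\bm x(t)-\bm y)+\lambda\tanh(\alpha\bm x(t))\right)$$ with given initial vector $\bm x(0)$. Let $\bm x^*=(x_1^*,\dots,x_n^* )^T$ be the equilibrium point of this ODE, that is, $$\bm A^T(\bm A\bm x^*-\bm y)+\lambda\tanh(\alpha\bm x^* )=\bm 0,$$ and let $\bm e(t)=\bm x(t)-\bm x^*$ be the residual error vector. Let $$\bm J(\bm x^* )=\mathrm{diag}\left(\frac{\alpha}{\cosh^2(\alpha x_1^* )},\dots,\frac{\alpha}{\cosh^2(\alpha x_n^* )}\right)$$ be the Jacobian matrix of $\bm x\mapsto\tanh(\alpha\bm x)$ at $\bm x^*$. Assume that the linear approximation around the equilibrium point, $$\tanh(\alpha(\bm x^*+\bm e))-\tanh(\alpha\bm x^* )\simeq\bm J(\bm x^* )\bm e,$$ is appropriate, in the sense that it is treated as an equality. If the initial vector $\bm x(0)$ is sufficiently close to $\bm x^*$, then $$\frac{\|\bm e(t)\|_2}{\|\bm e(0)\|_2}\le\exp(-\omega_1 t),$$ where $\{\omega_i\}_{i=1}^n$ is the set of eigenvalues of $\bm A^T\bm A+\lambda\bm J(\bm x^* )$, ordered as $0<\omega_1\le\omega_2\le\cdots\le\omega_n$.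
   Context: The function $\tanh$ is applied to vectors componentwise, $\|\cdot\|_2$ is the Euclidean norm, and $\mathrm{diag}(\cdot)$ is the diagonal matrix with the given diagonal entries. Treating the linear approximation as an equality, the residual error obeys $d\bm e(t)/dt=-(\bm A^T\bm A+\lambda\bm J(\bm x^* ))\bm e(t)$, so that $\bm e(t)=\exp\left(-(\bm A^T\bm A+\lambda\bm J(\bm x^* ))t\right)\bm e(0)$; this is expected to reflect the actual error behavior well when $\bm e(0)$ is sufficiently close to the zero vector. *)

theory Defs
  imports "HOL-Analysis.Analysis"
begin

definition tanh_vec :: "real^'n \<Rightarrow> real^'n" where
  "tanh_vec v = (\<chi> i. tanh (v $ i))"

definition diag :: "real^'n \<Rightarrow> real^'n^'n" where
  "diag d = (\<chi> i j. if i = j then d $ i else 0)"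

definition tanh_jacobian :: "real \<Rightarrow> real^'n \<Rightarrow> real^'n^'n" where
  "tanh_jacobian \<alpha> xs = diag (\<chi> i. \<alpha> / (cosh (\<alpha> * xs $ i))\<^sup>2)"

lemma tanh_jacobian_has_derivative:
  "((\<lambda>x. tanh_vec (\<alpha> *\<^sub>R x)) has_derivative (*v) (tanh_jacobian \<alpha> xs)) (at xs)"
proof -
  have *: "1 - (tanh u)\<^sup>2 = 1 / (cosh u)\<^sup>2" for u :: real
  proof -
    have "1 - (tanh u)\<^sup>2 = ((cosh u)\<^sup>2 - (sinh u)\<^sup>2) / (cosh u)\<^sup>2"
      by (simp add: tanh_def power_divide diff_divide_distrib)
    then show ?thesis by (simp add: hyperbolic_pythagoras)
  qed
  have "((\<lambda>x. tanh (\<alpha> * x $ i)) has_derivative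
      (\<lambda>h. (tanh_jacobian \<alpha> xs *v h) $ i)) (at xs)" for i
  proof -
    have "(tanh has_real_derivative 1 / (cosh (\<alpha> * xs $ i))\<^sup>2) (at (\<alpha> * xs $ i))"
      using has_field_derivative_tanh[of "\<lambda>u. u" "\<alpha> * xs $ i" 1 UNIV]
      by (simp add: *)
    moreover have "((\<lambda>x. \<alpha> * x $ i) has_derivative (\<lambda>h. \<alpha> * h $ i)) (at xs)"
      by (intro bounded_linear_imp_has_derivative bounded_linear_mult_right[THEN bounded_linear_compose]
          bounded_linear_vec_nth)
    ultimately have "((\<lambda>x. tanh (\<alpha> * x $ i)) has_derivative
        (\<lambda>h. 1 / (cosh (\<alpha> * xs $ i))\<^sup>2 * (\<alpha> * h $ i))) (at xs)"
      unfolding has_field_derivative_def by (rule has_derivative_compose[rotated])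
    moreover have "(tanh_jacobian \<alpha> xs *v h) $ i = 1 / (cosh (\<alpha> * xs $ i))\<^sup>2 * (\<alpha> * h $ i)" for h
      by (simp add: tanh_jacobian_def diag_def matrix_vector_mult_def if_distrib[of "\<lambda>u. u * _"] cong: if_cong)
    ultimately show ?thesis by simp
  qed
  then show ?thesis
    by (subst has_derivative_componentwise_within) (auto simp: Basis_vec_def inner_axis tanh_vec_def)
qed

text \<open>The ODE with a general activation \<open>g\<close>; the nonlinear ODE itself is
  \<open>g = (\<lambda>v. tanh_vec (\<alpha> *\<^sub>R v))\<close>.\<close>

definition ode_field :: "real^'n^'m \<Rightarrow> real^'m \<Rightarrow> real \<Rightarrow> (real^'n \<Rightarrow> real^'n) \<Rightarrow> real^'n \<Rightarrow> real^'n" where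
  "ode_field A y lam g v = - (transpose A *v (A *v v - y) + lam *\<^sub>R g v)"

definition ode_solution :: "(real^'n \<Rightarrow> real^'n) \<Rightarrow> (real \<Rightarrow> real^'n) \<Rightarrow> bool" where
  "ode_solution F x \<longleftrightarrow> (\<forall>t\<ge>0. (x has_vector_derivative F (x t)) (at t within {0..}))"

text \<open>The activation \<open>tanh_vec (\<alpha> *\<^sub>R v)\<close> with the approximation
  \<open>tanh_vec (\<alpha> *\<^sub>R (xs + e)) - tanh_vec (\<alpha> *\<^sub>R xs) = tanh_jacobian \<alpha> xs *v e\<close> read as an
  equality for \<open>norm e < r\<close>. Requiring this equality of \<open>tanh\<close> itself would be contradictory
  (near \<open>xs\<close> it holds exactly only for \<open>e = 0\<close>), so the activation is replaced by its
  linearization on the ball. A solution of the nonlinear ODE that happens to satisfy the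
  equality while in the ball is covered, see \<open>ode_solution_tanh_linearized\<close>.\<close>

definition tanh_linearized :: "real \<Rightarrow> real^'n \<Rightarrow> real \<Rightarrow> real^'n \<Rightarrow> real^'n" where
  "tanh_linearized \<alpha> xs r v =
     (if norm (v - xs) < r then tanh_vec (\<alpha> *\<^sub>R xs) + tanh_jacobian \<alpha> xs *v (v - xs)
      else tanh_vec (\<alpha> *\<^sub>R v))"

lemma ode_solution_tanh_linearized:
  assumes "ode_solution (ode_field A y lam (\<lambda>v. tanh_vec (\<alpha> *\<^sub>R v))) x"
    and "\<And>t. t \<ge> 0 \<Longrightarrow> norm (x t - xs) < r \<Longrightarrow>
           tanh_vec (\<alpha> *\<^sub>R x t) - tanh_vec (\<alpha> *\<^sub>R xs) = tanh_jacobian \<alpha> xs *v (x t - xs)"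
  shows "ode_solution (ode_field A y lam (tanh_linearized \<alpha> xs r)) x"
proof -
  have "tanh_linearized \<alpha> xs r (x t) = tanh_vec (\<alpha> *\<^sub>R x t)" if "t \<ge> 0" for t
    using assms(2)[OF that] by (auto simp: tanh_linearized_def algebra_simps)
  with assms(1) show ?thesis
    by (simp add: ode_solution_def ode_field_def)
qed

definition eigenvalue :: "real^'n^'n \<Rightarrow> real \<Rightarrow> bool" where
  "eigenvalue M k \<longleftrightarrow> (\<exists>v. v \<noteq> 0 \<and> M *v v = k *\<^sub>R v)"

text \<open>\<open>\<omega> 1 \<le> \<dots> \<le> \<omega> n\<close> enumerates the eigenvalues of \<open>M\<close>. Repetitions are allowed, in
  particular those given by the multiplicities.\<close>

definition ordered_eigenvalues :: "real^'n^'n \<Rightarrow> (nat \<Rightarrow> real) \<Rightarrow> bool" where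
  "ordered_eigenvalues M \<omega> \<longleftrightarrow>
     mono_on {1..CARD('n)} \<omega> \<and> \<omega> ` {1..CARD('n)} = {k. eigenvalue M k}"

end

(* Write M = A^T A + lam J. Along any solution, e . e' <= 0 holds everywhere: inside the ball of
   radius r because e' = -M e with M positive definite, outside because tanh is increasing. So
   |e| never grows and a solution starting in the ball stays in it. There the Rayleigh bound
   e . M e >= omega_1 |e|^2 gives the rate omega_1. *)
theory Submission
  imports Defs
begin

text \<open>A Gronwall argument: dissipativity makes
  \<open>exp (2 * k * s) * (e s \<bullet> e s)\<close>, the square of
  \<open>exp (k * s) * norm (e s)\<close>, nonincreasing. The main proof applies it twice, with
  \<open>k = 0\<close> and with \<open>k = \<omega> 1\<close>.\<close>

lemma norm_exp_decay:
  fixes e e' :: "real \<Rightarrow> 'a::real_inner"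
  assumes deriv: "\<And>s. s \<ge> 0 \<Longrightarrow> (e has_vector_derivative e' s) (at s within {0..})"
    and dissip: "\<And>s. s \<ge> 0 \<Longrightarrow> e s \<bullet> e' s \<le> - k * (e s \<bullet> e s)"
    and "t \<ge> 0"
  shows "norm (e t) \<le> exp (- k * t) * norm (e 0)"
proof -
  define u where "u s = exp (2 * k * s) * (e s \<bullet> e s)" for s
  define u' where "u' s = 2 * exp (2 * k * s) * (k * (e s \<bullet> e s) + e s \<bullet> e' s)" for s
  have u: "(u has_real_derivative u' s) (at s within {0..})" if "s \<ge> 0" for s
  proof -
    have "((\<lambda>s. e s \<bullet> e s) has_real_derivative 2 * (e s \<bullet> e' s)) (at s within {0..})"
      using has_derivative_inner[OF deriv[OF that, unfolded has_vector_derivative_def]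
          deriv[OF that, unfolded has_vector_derivative_def]]
      unfolding has_field_derivative_def
      by (rule has_derivative_eq_rhs) (auto simp: inner_commute)
    then show ?thesis
      unfolding u_def u'_def
      by (auto intro!: derivative_eq_intros simp: algebra_simps)
  qed
  have "u t \<le> u 0"
  proof (rule DERIV_nonpos_imp_decreasing_open[OF \<open>t \<ge> 0\<close>])
    fix s assume s: "0 < s" "s < t"
    \<comment> \<open>At an interior point the derivative within the half-line is the two-sided one;
      the endpoint 0 is covered by continuity.\<close>
    then have "(u has_real_derivative u' s) (at s)"
      using u[of s] at_within_interior[of s "{0..}"] by simp
    moreover have "u' s \<le> 0"
      using dissip[of s] s unfolding u'_def by (intro mult_nonneg_nonpos) simp_all
    ultimately show "\<exists>d. (u has_real_derivative d) (at s) \<and> d \<le> 0" by blast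
  next
    have "continuous_on {0..} u"
      by (rule DERIV_continuous_on[OF u]) simp
    then show "continuous_on {0..t} u"
      by (rule continuous_on_subset) auto
  qed
  then have "(exp (k * t) * norm (e t))\<^sup>2 \<le> (norm (e 0))\<^sup>2"
    by (simp add: u_def power_mult_distrib power2_norm_eq_inner mult.assoc flip: exp_double)
  then have "exp (k * t) * norm (e t) \<le> norm (e 0)"
    by (rule power2_le_imp_le) simp
  then show ?thesis
    by (simp add: exp_minus field_simps)
qed

text \<open>The form attains its minimum 0 at \<open>v\<close>, so its gradient
  \<open>2 * N v\<close> must vanish there. Concretely, a short step from \<open>v\<close> along
  \<open>- N v\<close> would otherwise make the form negative.\<close>

lemma symmetric_psd_null_vector:
  fixes N :: "real^'n^'n"
  assumes sym: "transpose N = N"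
    and psd: "\<And>v. v \<bullet> (N *v v) \<ge> 0"
    and "v \<bullet> (N *v v) = 0"
  shows "N *v v = 0"
proof (rule ccontr)
  assume "N *v v \<noteq> 0"
  define w where "w = N *v v"
  define a where "a = w \<bullet> w"
  define b where "b = w \<bullet> (N *v w)"
  \<comment> \<open>Moving by \<open>s\<close> changes the form by
    \<open>s * (s * b - 2 * a)\<close>. This is negative for the chosen \<open>s\<close> because
    \<open>s * b \<le> a\<close>; the summand 1 keeps the denominator positive when
    \<open>b = 0\<close>.\<close>
  define s where "s = a / (b + 1)"
  have "a > 0" using \<open>N *v v \<noteq> 0\<close> by (simp add: a_def w_def)
  have "b \<ge> 0" using psd by (simp add: b_def)
  \<comment> \<open>Symmetry moves \<open>N\<close> onto \<open>v\<close>, so both cross terms in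
    the expansion below equal \<open>a\<close>.\<close>
  have "v \<bullet> (N *v w) = a"
    using dot_lmul_matrix[of v N w] transpose_matrix_vector[of N v] sym
    by (simp add: a_def w_def)
  then have "(v - s *\<^sub>R w) \<bullet> (N *v (v - s *\<^sub>R w)) = s * (s * b - 2 * a)"
    using assms(3)
    by (simp add: matrix_vector_mult_diff_distrib matrix_vector_mult_scaleR inner_diff_left
        inner_diff_right a_def b_def algebra_simps flip: w_def)
  then have "0 \<le> s * (s * b - 2 * a)"
    using psd by metis
  moreover have "s > 0"
    using \<open>a > 0\<close> \<open>b \<ge> 0\<close> by (simp add: s_def)
  ultimately have "2 * a \<le> s * b"
    by (simp add: zero_le_mult_iff)
  also have "s * b \<le> a"
    using \<open>a > 0\<close> \<open>b \<ge> 0\<close> by (simp add: s_def field_simps)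
  finally show False
    using \<open>a > 0\<close> by simp
qed

text \<open>Take \<open>k\<close> to be the minimum of the quadratic form on the unit sphere,
  attained by compactness. Then \<open>M - k I\<close> is positive semidefinite and its form
  vanishes at the minimizer, which is therefore an eigenvector. This reaches the smallest eigenvalue
  without diagonalizing \<open>M\<close>.\<close>

lemma symmetric_Rayleigh_min_eigenvalue:
  fixes M :: "real^'n^'n"
  assumes sym: "transpose M = M"
  obtains k where "eigenvalue M k" "\<And>v. v \<bullet> (M *v v) \<ge> k * (v \<bullet> v)"
proof -
  have "continuous_on (sphere 0 1) (\<lambda>v. v \<bullet> (M *v v))"
    by (intro continuous_intros linear_continuous_on matrix_vector_mul_bounded_linear)
  moreover have "sphere 0 1 \<noteq> ({} :: (real^'n) set)"
    using vector_choose_size[of 1] by auto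
  ultimately obtain v where v: "norm v = 1"
    and min: "\<And>w. norm w = 1 \<Longrightarrow> v \<bullet> (M *v v) \<le> w \<bullet> (M *v w)"
    using continuous_attains_inf[OF compact_sphere, of 0 1 "\<lambda>v. v \<bullet> (M *v v)"] by auto
  define k where "k = v \<bullet> (M *v v)"
  have bound: "w \<bullet> (M *v w) \<ge> k * (w \<bullet> w)" for w
  proof (cases "w = 0")
    case False
    then have "k \<le> sgn w \<bullet> (M *v sgn w)"
      unfolding k_def by (intro min) (simp add: norm_sgn)
    also have "\<dots> = w \<bullet> (M *v w) / (w \<bullet> w)"
      by (simp add: sgn_div_norm matrix_vector_mult_scaleR divide_inverse
          flip: power2_norm_eq_inner) (simp add: power2_eq_square)
    finally show ?thesis
      using False by (simp add: field_simps)
  qed simp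
  define N where "N = M - k *\<^sub>R mat 1"
  have N: "N *v w = M *v w - k *\<^sub>R w" for w
    by (simp add: N_def matrix_vector_mult_diff_rdistrib scaleR_matrix_vector_assoc[symmetric])
  have "transpose N = N"
    using sym by (simp add: N_def vec_eq_iff transpose_def mat_def)
  then have "N *v v = 0"
    by (rule symmetric_psd_null_vector)
      (use bound v in \<open>auto simp: N inner_diff_right k_def norm_eq_1\<close>)
  then have "eigenvalue M k"
    using v unfolding eigenvalue_def N by (intro exI[of _ v]) auto
  with bound show thesis by (rule that[rotated])
qed

text \<open>In each coordinate the two differences have the same sign, since tanh is
  increasing.\<close>

lemma tanh_vec_monotone:
  assumes "\<alpha> \<ge> 0"
  shows "(v - w) \<bullet> (tanh_vec (\<alpha> *\<^sub>R v) - tanh_vec (\<alpha> *\<^sub>R w)) \<ge> 0"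
  unfolding inner_vec_def
proof (rule sum_nonneg)
  fix i
  show "(v - w) $ i \<bullet> (tanh_vec (\<alpha> *\<^sub>R v) - tanh_vec (\<alpha> *\<^sub>R w)) $ i \<ge> 0"
    using assms mult_left_mono[of "v $ i" "w $ i" \<alpha>] mult_left_mono[of "w $ i" "v $ i" \<alpha>]
    by (cases "v $ i \<le> w $ i") (auto simp: tanh_vec_def zero_le_mult_iff)
qed

lemma tanh_jacobian_mult: "(tanh_jacobian \<alpha> xs *v v) $ i = \<alpha> / (cosh (\<alpha> * xs $ i))\<^sup>2 * v $ i"
  by (simp add: tanh_jacobian_def diag_def matrix_vector_mult_def if_distrib[of "\<lambda>u. u * _"]
      cong: if_cong)

text \<open>All diagonal entries are positive. This is what makes \<open>M\<close> positive definite
  even when the Gram matrix of \<open>A\<close> is singular.\<close>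

lemma tanh_jacobian_pos:
  assumes "\<alpha> > 0" "v \<noteq> 0"
  shows "v \<bullet> (tanh_jacobian \<alpha> xs *v v) > 0"
proof -
  from \<open>v \<noteq> 0\<close> obtain i where i: "v $ i \<noteq> 0"
    by (auto simp: vec_eq_iff)
  have "v $ j \<bullet> (tanh_jacobian \<alpha> xs *v v) $ j = \<alpha> / (cosh (\<alpha> * xs $ j))\<^sup>2 * (v $ j)\<^sup>2" for j
    by (simp add: tanh_jacobian_mult power2_eq_square)
  then show ?thesis
    unfolding inner_vec_def using assms i
    by (intro sum_pos2[of _ i]) (auto simp del: times_divide_eq_left)
qed

theorem theorem1:
  fixes A :: "real^'n^'m" and y :: "real^'m" and lam \<alpha> r :: real
    and xs :: "real^'n" and \<omega> :: "nat \<Rightarrow> real"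
  assumes "lam > 0" and "\<alpha> > 0" and "r > 0"
    and equilibrium: "transpose A *v (A *v xs - y) + lam *\<^sub>R tanh_vec (\<alpha> *\<^sub>R xs) = 0"
    and eigenvalues: "ordered_eigenvalues (transpose A ** A + lam *\<^sub>R tanh_jacobian \<alpha> xs) \<omega>"
  shows "0 < \<omega> 1 \<and>
    (\<exists>\<delta>>0. \<forall>x :: real \<Rightarrow> real^'n.
       ode_solution (ode_field A y lam (tanh_linearized \<alpha> xs r)) x \<longrightarrow>
       norm (x 0 - xs) < \<delta> \<longrightarrow>
       (\<forall>t\<ge>0. norm (x t - xs) / norm (x 0 - xs) \<le> exp (- \<omega> 1 * t)))"
proof -
  define J where "J = tanh_jacobian \<alpha> xs"
  define M where "M = transpose A ** A + lam *\<^sub>R J"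
  define F where "F = ode_field A y lam (tanh_linearized \<alpha> xs r)"
  have gram: "v \<bullet> (transpose A *v (A *v v)) = (norm (A *v v))\<^sup>2" for v
    using dot_lmul_matrix[of v "transpose A" "A *v v"]
    by (simp add: power2_norm_eq_inner)
  have M_mult: "M *v v = transpose A *v (A *v v) + lam *\<^sub>R (J *v v)" for v
    by (simp add: M_def matrix_vector_mult_add_rdistrib scaleR_matrix_vector_assoc[symmetric]
        matrix_vector_mul_assoc)
  have M_pos: "v \<bullet> (M *v v) > 0" if "v \<noteq> 0" for v
    using tanh_jacobian_pos[OF \<open>\<alpha> > 0\<close> that, of xs] \<open>lam > 0\<close>
    unfolding M_mult inner_add_right gram J_def by (simp add: add_nonneg_pos)

  have "transpose M = M"
  proof -
    have "transpose J = J"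
      by (auto simp: vec_eq_iff J_def tanh_jacobian_def diag_def transpose_def)
    moreover have "transpose M = transpose (transpose A ** A) + lam *\<^sub>R transpose J"
      by (simp add: M_def vec_eq_iff transpose_def)
    ultimately show ?thesis
      by (simp add: M_def matrix_transpose_mul)
  qed
  then obtain k where k: "eigenvalue M k" and Rayleigh: "\<And>v. v \<bullet> (M *v v) \<ge> k * (v \<bullet> v)"
    by (rule symmetric_Rayleigh_min_eigenvalue) blast
  have mono: "mono_on {1..CARD('n)} \<omega>" and image: "\<omega> ` {1..CARD('n)} = {k. eigenvalue M k}"
    using eigenvalues by (auto simp: ordered_eigenvalues_def M_def J_def)
  have one: "1 \<in> {1..CARD('n)}"
    by (simp add: Suc_leI)
  then have "eigenvalue M (\<omega> 1)"
    using image by blast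
  then obtain v where "v \<noteq> 0" "M *v v = \<omega> 1 *\<^sub>R v"
    by (auto simp: eigenvalue_def)
  then have "0 < \<omega> 1 * (v \<bullet> v)"
    using M_pos[of v] by simp
  then have "0 < \<omega> 1"
    using zero_less_mult_pos2 \<open>v \<noteq> 0\<close> inner_gt_zero_iff by blast
  \<comment> \<open>The Rayleigh minimum \<open>k\<close> occurs somewhere in the enumeration, so
    the ordering puts \<open>\<omega> 1\<close> below it and the Rayleigh bound holds with
    \<open>\<omega> 1\<close> as well.\<close>
  from k image obtain i where i: "i \<in> {1..CARD('n)}" "\<omega> i = k"
    by (metis imageE mem_Collect_eq)
  then have "\<omega> 1 \<le> k"
    using mono_onD[OF mono one i(1)] by simp
  have M_bound: "v \<bullet> (M *v v) \<ge> \<omega> 1 * (v \<bullet> v)" for v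
    using Rayleigh[of v] mult_right_mono[OF \<open>\<omega> 1 \<le> k\<close>, of "v \<bullet> v"] by simp

  \<comment> \<open>Subtracting the equilibrium equation removes \<open>y\<close> and expresses the
    field through the error \<open>v - xs\<close>.\<close>
  have F_eq: "F v = - (transpose A *v (A *v (v - xs))
      + lam *\<^sub>R (tanh_linearized \<alpha> xs r v - tanh_vec (\<alpha> *\<^sub>R xs)))" for v
    using equilibrium
    by (simp add: F_def ode_field_def matrix_vector_mult_diff_distrib algebra_simps)
  have inside: "(v - xs) \<bullet> F v \<le> - \<omega> 1 * ((v - xs) \<bullet> (v - xs))" if "norm (v - xs) < r" for v
  proof -
    have "F v = - (M *v (v - xs))"
      using that by (simp add: F_eq M_mult tanh_linearized_def J_def)
    then show ?thesis
      using M_bound[of "v - xs"] by simp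
  qed
  \<comment> \<open>The field may jump on the sphere of radius \<open>r\<close>, but this sign holds
    pointwise on both sides, so solutions can be treated without a first exit time.\<close>
  have dissip: "(v - xs) \<bullet> F v \<le> 0" for v
  proof (cases "norm (v - xs) < r")
    case True
    moreover have "0 \<le> \<omega> 1 * ((v - xs) \<bullet> (v - xs))"
      using \<open>0 < \<omega> 1\<close> by simp
    ultimately show ?thesis
      using inside[of v] by simp
  next
    case False
    then have "(v - xs) \<bullet> F v = - ((norm (A *v (v - xs)))\<^sup>2
        + lam * ((v - xs) \<bullet> (tanh_vec (\<alpha> *\<^sub>R v) - tanh_vec (\<alpha> *\<^sub>R xs))))"
      unfolding F_eq inner_minus_right inner_add_right gram
      by (simp add: tanh_linearized_def)
    moreover have "0 \<le> lam * ((v - xs) \<bullet> (tanh_vec (\<alpha> *\<^sub>R v) - tanh_vec (\<alpha> *\<^sub>R xs)))"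
      using tanh_vec_monotone[of \<alpha> v xs] \<open>lam > 0\<close> \<open>\<alpha> > 0\<close> by simp
    ultimately show ?thesis
      using zero_le_power2[of "norm (A *v (v - xs))"] by linarith
  qed

  have "norm (x t - xs) / norm (x 0 - xs) \<le> exp (- \<omega> 1 * t)"
    if sol: "ode_solution F x" and start: "norm (x 0 - xs) < r" and "t \<ge> 0" for x t
  proof -
    have deriv: "((\<lambda>t. x t - xs) has_vector_derivative F (x s)) (at s within {0..})"
      if "s \<ge> 0" for s
      using sol that unfolding ode_solution_def
      by (auto intro!: derivative_eq_intros)
    \<comment> \<open>Rate 0 first: the error never exceeds its initial size, so the sharper bound
      \<open>inside\<close> is available at all times for the second application.\<close>
    have "norm (x s - xs) < r" if "s \<ge> 0" for s
      using norm_exp_decay[OF deriv, of 0 s] dissip start that by fastforce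
    then have "norm (x t - xs) \<le> exp (- \<omega> 1 * t) * norm (x 0 - xs)"
      by (intro norm_exp_decay[OF deriv]) (use inside \<open>t \<ge> 0\<close> in auto)
    \<comment> \<open>If \<open>x 0 = xs\<close> the quotient is \<open>0\<close> by the convention for division by zero.\<close>
    then show ?thesis
      by (cases "x 0 = xs") (simp_all add: divide_le_eq)
  qed
  \<comment> \<open>The radius \<open>r\<close> itself serves as the witness for \<delta>.\<close>
  with \<open>0 < \<omega> 1\<close> \<open>r > 0\<close> show ?thesis
    unfolding F_def by blast
qed

end
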